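(* A signed cylindrical grid of the form $C_m^{(r_1)}\times P_n^{(r_2)}$, where $0\le r_1\le m$ and $0\le r_2\le n-1$, has the eigenvalues $$\lambda_{ij}=2\Big(\cos\frac{(2i-[r_1])\pi}{m}+\cos\frac{2j\pi}{n+1}\Big)$$ for $1\le i\le m$ and $1\le j\le n$. The energy is $$E(C_m^{(r_1)}\times P_n^{(r_2)})=2\sum_{i=1}^m\sum_{j=1}^n\Big|\cos\frac{(2i-[r_1])\pi}{m}+\cos\frac{2j\pi}{n+1}\Big|.$$ The Laplacian eigenvalues are given by $$\lambda_{ij}^L=2\Big(2-\cos\frac{(2i-[r_1])\pi}{m}+\cos\frac{2j\pi}{n}\Big)$$ for $1\le i\le m$ and $1\le j\le n$, of which all are positive, except for $\lambda_{mn}^L$ when $r_1$ is even. The Laplacian energy is $$E_L(C_m^{(r_1)}\times P_n^{(r_2)})=2\sum_{i=1}^m\sum_{j=1}^n\Big|1-\frac1n-\cos\frac{(2i-[r_1])\pi}{m}+\cos\frac{2j\pi}{n}\Big|.$$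
   Context: For an integer $r$, $[r]=0$ if $r$ is even and $[r]=1$ if $r$ is odd. A signed graph $\Sigma=(G,\sigma)$ is a finite simple graph $G=(V,E)$ with a function $\sigma:E\to\{+1,-1\}$. The adjacency matrix $A(\Sigma)$ has $(u,v)$ entry $\sigma(uv)$ if $u,v$ are adjacent and $0$ otherwise; its eigenvalues are the eigenvalues of $\Sigma$, and the energy $E(\Sigma)$ is the sum of their absolute values. The Laplacian matrix is $L(\Sigma)=D(\Sigma)-A(\Sigma)$, $D(\Sigma)$ being the diagonal matrix of vertex degrees; its eigenvalues are the Laplacian eigenvalues. The Laplacian energy is $E_L(\Sigma)=\sum_j|\lambda_j(L(\Sigma))-\bar d(\Sigma)|$, where $\lambda_j(L(\Sigma))$ are the eigenvalues of $L(\Sigma)$ and $\bar d(\Sigma)=2|E|/|V|$. The Cartesian product of signed graphs $\Sigma_i=(V_i,E_i,\sigma_i)$, $i=1,2$, is the signed graph on $V_1\times V_2$ in which $(u,v)(u',v')$ is an edge iff $v=v'$ and $uu'\in E_1$ (sign $\sigma_1(uu')$), or $u=u'$ and $vv'\in E_2$ (sign $\sigma_2(vv')$). $P_n^{(r)}$ denotes a signed path with $n$ vertices having exactly $r$ negative edges; $C_m^{(r)}$ denotes a signed cycle with $m$ vertices having exactly $r$ negative edges.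
   Formalization: The printed formulas fail (e.g. for n=1) and are corrected: the path angles are jπ/(n+1) instead of 2jπ/(n+1) for eigenvalues and energy, jπ/n instead of 2jπ/n in both Laplacian formulas, and the constant in the Laplacian energy is 1/n instead of 1-1/n. *)

theory Defs
  imports Complex_Main "Jordan_Normal_Form.Char_Poly"
begin

section \<open>Signed graphs\<close>

record 'a sgraph =
  verts :: "'a set"
  edges :: "'a set set"
  esign :: "'a set \<Rightarrow> int"

text \<open>Only the values of \<open>esign\<close> on edges are meaningful.\<close>

definition signed_graph :: "'a sgraph \<Rightarrow> bool" where
  "signed_graph S \<longleftrightarrow> finite (verts S) \<and>
     (\<forall>e \<in> edges S. e \<subseteq> verts S \<and> card e = 2) \<and>
     (\<forall>e \<in> edges S. esign S e \<in> {1, -1})"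

definition negative_edges :: "'a sgraph \<Rightarrow> 'a set set" where
  "negative_edges S = {e \<in> edges S. esign S e = -1}"

definition vertex_degree :: "'a sgraph \<Rightarrow> 'a \<Rightarrow> nat" where
  "vertex_degree S v = card {e \<in> edges S. v \<in> e}"

definition average_degree :: "'a sgraph \<Rightarrow> real" where
  "average_degree S = 2 * real (card (edges S)) / real (card (verts S))"

text \<open>
  For an edge \<open>e = {(u, v), (u', v')}\<close> of the product, the projection \<open>fst ` e\<close> is an edge
  of the first factor if \<open>v = v'\<close>, and a singleton (hence not an edge) if \<open>u = u'\<close>.
\<close>

definition cartesian_product :: "'a sgraph \<Rightarrow> 'b sgraph \<Rightarrow> ('a \<times> 'b) sgraph" where
  "cartesian_product S T =
     \<lparr> verts = verts S \<times> verts T,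
       edges = {{(u, v), (u', v)} | u u' v. {u, u'} \<in> edges S \<and> v \<in> verts T} \<union>
               {{(u, v), (u, v')} | u v v'. u \<in> verts S \<and> {v, v'} \<in> edges T},
       esign = (\<lambda>e. if fst ` e \<in> edges S then esign S (fst ` e) else esign T (snd ` e)) \<rparr>"

definition is_signed_path :: "nat \<Rightarrow> nat \<Rightarrow> 'a sgraph \<Rightarrow> bool" where
  "is_signed_path n r S \<longleftrightarrow> signed_graph S \<and> n \<ge> 1 \<and>
     (\<exists>f. bij_betw f {0..<n} (verts S) \<and> edges S = {{f i, f (i + 1)} | i. i + 1 < n}) \<and>
     card (negative_edges S) = r"

definition is_signed_cycle :: "nat \<Rightarrow> nat \<Rightarrow> 'a sgraph \<Rightarrow> bool" where
  "is_signed_cycle m r S \<longleftrightarrow> signed_graph S \<and> m \<ge> 3 \<and>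
     (\<exists>f. bij_betw f {0..<m} (verts S) \<and> edges S = {{f i, f ((i + 1) mod m)} | i. i < m}) \<and>
     card (negative_edges S) = r"


section \<open>Matrices and spectra\<close>

text \<open>
  Matrices are indexed by numbers, so a vertex-indexed matrix is formed along a list enumerating
  the vertices. The characteristic polynomial does not depend on the list: see
  \<open>char_poly_matrix_along\<close> below.
\<close>

definition matrix_along :: "'a list \<Rightarrow> ('a \<Rightarrow> 'a \<Rightarrow> real) \<Rightarrow> real mat" where
  "matrix_along vs f = mat (length vs) (length vs) (\<lambda>(i, j). f (vs ! i) (vs ! j))"

definition vertex_list :: "'a sgraph \<Rightarrow> 'a list" where
  "vertex_list S = (SOME vs. distinct vs \<and> set vs = verts S)"

lemma vertex_list:
  assumes "finite (verts S)"
  shows "distinct (vertex_list S)" and "set (vertex_list S) = verts S"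
proof -
  have "\<exists>vs. distinct vs \<and> set vs = verts S"
    using finite_distinct_list[OF assms] by blast
  from someI_ex[OF this] show "distinct (vertex_list S)" "set (vertex_list S) = verts S"
    unfolding vertex_list_def by auto
qed

definition adjacency_matrix :: "'a sgraph \<Rightarrow> real mat" where
  "adjacency_matrix S = matrix_along (vertex_list S)
     (\<lambda>u v. if {u, v} \<in> edges S then real_of_int (esign S {u, v}) else 0)"

definition degree_matrix :: "'a sgraph \<Rightarrow> real mat" where
  "degree_matrix S = matrix_along (vertex_list S)
     (\<lambda>u v. if u = v then real (vertex_degree S v) else 0)"

definition laplacian_matrix :: "'a sgraph \<Rightarrow> real mat" where
  "laplacian_matrix S = degree_matrix S - adjacency_matrix S"

text \<open>
  Eigenvalues are counted with algebraic multiplicity. The adjacency and Laplacian matrices are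
  real and symmetric, so no eigenvalue is lost by taking roots over the reals.
\<close>

definition eigenvalues :: "'a sgraph \<Rightarrow> real multiset" where
  "eigenvalues S = proots (char_poly (adjacency_matrix S))"

definition laplacian_eigenvalues :: "'a sgraph \<Rightarrow> real multiset" where
  "laplacian_eigenvalues S = proots (char_poly (laplacian_matrix S))"

definition energy :: "'a sgraph \<Rightarrow> real" where
  "energy S = (\<Sum>x \<in># eigenvalues S. \<bar>x\<bar>)"

definition laplacian_energy :: "'a sgraph \<Rightarrow> real" where
  "laplacian_energy S = (\<Sum>x \<in># laplacian_eigenvalues S. \<bar>x - average_degree S\<bar>)"

lemma char_poly_matrix_along:
  assumes vs: "distinct vs" and ws: "distinct ws" and eq: "set vs = set ws"
  shows "char_poly (matrix_along vs f) = char_poly (matrix_along ws f)"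
proof -
  define n where "n = length vs"
  have n': "length ws = n"
    using distinct_card[OF vs] distinct_card[OF ws] eq n_def by simp
  define Q :: "'a list \<Rightarrow> 'a list \<Rightarrow> real mat" where
    "Q = (\<lambda>xs ys. mat n n (\<lambda>(i, j). if xs ! i = ys ! j then 1 else 0))"
  have pick: "(\<Sum>k = 0..<n. (if x = xs ! k then 1 else 0) * g (xs ! k)) = (g x :: real)"
             "(\<Sum>k = 0..<n. g (xs ! k) * (if xs ! k = x then 1 else 0)) = (g x :: real)"
    if xs: "distinct xs" "length xs = n" "x \<in> set xs" for xs :: "'a list" and x g
  proof -
    have bij: "bij_betw (\<lambda>k. xs ! k) {0..<n} (set xs)"
      using bij_betw_nth[OF xs(1), of "{..<n}" "set xs"] xs(2) by (simp add: atLeast0LessThan)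
    have "(\<Sum>k = 0..<n. (if x = xs ! k then 1 else 0) * g (xs ! k)) =
        (\<Sum>y \<in> set xs. (if x = y then 1 else 0) * g y)"
      by (rule sum.reindex_bij_betw[OF bij])
    also have "\<dots> = (\<Sum>y \<in> set xs. if x = y then g y else 0)"
      by (intro sum.cong) auto
    finally show "(\<Sum>k = 0..<n. (if x = xs ! k then 1 else 0) * g (xs ! k)) = g x"
      using xs(3) by simp
    have "(\<Sum>k = 0..<n. g (xs ! k) * (if xs ! k = x then 1 else 0)) =
        (\<Sum>y \<in> set xs. g y * (if y = x then 1 else 0))"
      by (rule sum.reindex_bij_betw[OF bij])
    also have "\<dots> = (\<Sum>y \<in> set xs. if y = x then g y else 0)"
      by (intro sum.cong) auto
    finally show "(\<Sum>k = 0..<n. g (xs ! k) * (if xs ! k = x then 1 else 0)) = g x"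
      using xs(3) by simp
  qed
  have inv: "Q xs ys * Q ys xs = 1\<^sub>m n"
    if "distinct xs" "distinct ys" "length xs = n" "length ys = n" "set xs = set ys" for xs ys
  proof (rule eq_matI)
    fix i j assume "i < dim_row (1\<^sub>m n)" "j < dim_col (1\<^sub>m n)"
    then have ij: "i < n" "j < n" by auto
    have mem: "xs ! i \<in> set ys" using ij that by (metis nth_mem)
    have "(Q xs ys * Q ys xs) $$ (i, j) =
        (\<Sum>k = 0..<n. (if xs ! i = ys ! k then 1 else 0) * (if ys ! k = xs ! j then 1 else 0))"
      unfolding Q_def times_mat_def scalar_prod_def using ij by simp
    also have "\<dots> = (if xs ! i = xs ! j then 1 else 0)"
      by (rule pick(1)[OF that(2) that(4) mem])
    finally have "(Q xs ys * Q ys xs) $$ (i, j) = (if xs ! i = xs ! j then 1 else 0)" .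
    then show "(Q xs ys * Q ys xs) $$ (i, j) = 1\<^sub>m n $$ (i, j)"
      using ij that by (simp add: nth_eq_iff_index_eq)
  qed (auto simp: Q_def)
  have M: "matrix_along vs f = Q vs ws * matrix_along ws f * Q ws vs"
  proof (rule eq_matI)
    fix i j assume "i < dim_row (Q vs ws * matrix_along ws f * Q ws vs)"
      "j < dim_col (Q vs ws * matrix_along ws f * Q ws vs)"
    then have ij: "i < n" "j < n" by (auto simp: Q_def)
    have mem: "vs ! i \<in> set ws" "vs ! j \<in> set ws"
      using ij nth_mem[of i vs] nth_mem[of j vs] eq n_def by simp_all
    have dims: "dim_row (matrix_along ws f) = n" "dim_col (matrix_along ws f) = n"
      by (simp_all add: matrix_along_def n')
    have row: "(Q vs ws * matrix_along ws f) $$ (i, l) = f (vs ! i) (ws ! l)" if "l < n" for l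
    proof -
      have "(Q vs ws * matrix_along ws f) $$ (i, l) =
          (\<Sum>k = 0..<n. (if vs ! i = ws ! k then 1 else 0) * f (ws ! k) (ws ! l))"
        unfolding Q_def matrix_along_def times_mat_def scalar_prod_def using ij that n' by simp
      also have "\<dots> = f (vs ! i) (ws ! l)"
        by (rule pick(1)[OF ws n' mem(1)])
      finally show ?thesis .
    qed
    have "(Q vs ws * matrix_along ws f * Q ws vs) $$ (i, j) =
        (\<Sum>l = 0..<n. (Q vs ws * matrix_along ws f) $$ (i, l) * Q ws vs $$ (l, j))"
      unfolding times_mat_def[of "Q vs ws * matrix_along ws f"] scalar_prod_def
      using ij dims by (simp add: Q_def)
    also have "\<dots> = (\<Sum>l = 0..<n. f (vs ! i) (ws ! l) * (if ws ! l = vs ! j then 1 else 0))"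
      by (intro sum.cong refl arg_cong2[where f = "(*)"]) (use ij row in \<open>simp_all add: Q_def\<close>)
    also have "\<dots> = f (vs ! i) (vs ! j)"
      by (rule pick(2)[OF ws n' mem(2)])
    finally show "matrix_along vs f $$ (i, j) = (Q vs ws * matrix_along ws f * Q ws vs) $$ (i, j)"
      using ij by (simp add: matrix_along_def n_def)
  qed (auto simp: Q_def matrix_along_def n_def)
  have "{matrix_along vs f, matrix_along ws f, Q vs ws, Q ws vs} \<subseteq> carrier_mat n n"
    unfolding Q_def matrix_along_def n_def using n' n_def by auto
  then have "similar_mat (matrix_along vs f) (matrix_along ws f)"
    by (rule similar_matI[OF _ inv[OF vs ws n_def[symmetric] n' eq]
          inv[OF ws vs n' n_def[symmetric] eq[symmetric]] M])
  then show ?thesis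
    by (rule char_poly_similar)
qed


section \<open>The parity bracket\<close>

definition parity :: "nat \<Rightarrow> real" where
  "parity r = (if even r then 0 else 1)"

text \<open>
  The statement corrects misprints in the source formulas. The angles coming from the \<open>n\<close>-path are \<open>j \<pi> / (n + 1)\<close> for the
  adjacency matrix and \<open>j \<pi> / n\<close> for the Laplacian (the source prints \<open>2 j \<pi>\<close> in both), and since
  the average degree of the product is \<open>4 - 2 / n\<close>, the constant in the Laplacian energy
  is \<open>1 / n\<close> (the source prints \<open>1 - 1 / n\<close>).
\<close>

end

theory Submission
  imports Defs
begin

text \<open>
  The adjacency and Laplacian kernels of a Cartesian product are Kronecker sums of those of the
  factors, so orthogonal eigenbases of the factors multiply to one of the product and their
  eigenvalues add. Switching (conjugation by a diagonal matrix of signs) removes all signs from a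
  path, and from a cycle all but one, leaving the sign \<open>(- 1) ^ r\<close> on a single edge. The
  path kernels have the classical sine and cosine eigenvectors, which are orthogonal because the
  eigenvalues are distinct. On the cycle eigenvalues repeat; there the real Hartley functions
  \<open>cos x + sin x\<close>, with angles shifted for odd \<open>r\<close> so that they are antiperiodic, form an
  orthogonal eigenbasis.
\<close>

section \<open>Orthogonal eigenbases and Kronecker sums\<close>

text \<open>The claims concern multisets of roots of characteristic polynomials, so multiplicities
  matter, and a product may have repeated eigenvalues even when neither factor does. Hence the
  object carried through is a full orthogonal eigenbasis with an index set: it diagonalizes the
  matrix explicitly, whether or not eigenvalues coincide. The Laplacian needs no separate theory of
  degrees. Since edge weights are 1 or -1, the degree of a vertex is the absolute row sum of the
  adjacency kernel. Absolute values ignore switching and add up over a product of loopless graphs,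
  so the Laplacian follows the adjacency kernel through both constructions. The same absolute sums
  count edges and give the average degree 4 - 2 / n. The Laplacian of a path has eigenvalues 2 - 2
  cos (k pi / n) with 0 \<le> k < n. The plus sign in the required formula comes from k = n - j,
  which puts the constant eigenvector at j = n and makes (m, n) the only index at which a Laplacian
  eigenvalue of the grid can vanish.\<close>

text \<open>The final clause says both that the eigenvectors are orthogonal and that they are nonzero.\<close>

definition eigenbasis ::
  "'v set \<Rightarrow> ('v \<Rightarrow> 'v \<Rightarrow> real) \<Rightarrow> 'k set \<Rightarrow> ('k \<Rightarrow> 'v \<Rightarrow> real) \<Rightarrow> ('k \<Rightarrow> real) \<Rightarrow> bool" where
  "eigenbasis V f K \<phi> \<mu> \<longleftrightarrow> finite V \<and> finite K \<and> card K = card V \<and>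
     (\<forall>k\<in>K. \<forall>u\<in>V. (\<Sum>v\<in>V. f u v * \<phi> k v) = \<mu> k * \<phi> k u) \<and>
     (\<forall>k\<in>K. \<forall>l\<in>K. (\<Sum>v\<in>V. \<phi> k v * \<phi> l v) = 0 \<longleftrightarrow> k \<noteq> l)"

lemma eigenbasisD:
  assumes "eigenbasis V f K \<phi> \<mu>"
  shows "finite V" "finite K" "card K = card V"
    and "\<And>k u. k \<in> K \<Longrightarrow> u \<in> V \<Longrightarrow> (\<Sum>v\<in>V. f u v * \<phi> k v) = \<mu> k * \<phi> k u"
    and "\<And>k l. k \<in> K \<Longrightarrow> l \<in> K \<Longrightarrow> (\<Sum>v\<in>V. \<phi> k v * \<phi> l v) = 0 \<longleftrightarrow> k \<noteq> l"
  using assms unfolding eigenbasis_def by auto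

lemma sum_nth:
  fixes g :: "'a \<Rightarrow> 'b::comm_monoid_add"
  assumes "distinct xs" shows "(\<Sum>i = 0..<length xs. g (xs ! i)) = sum g (set xs)"
  using sum.reindex_bij_betw[OF bij_betw_nth[OF assms refl refl], of g]
  by (simp add: atLeast0LessThan)

text \<open>The matrix with the eigenvectors as columns has an explicit inverse: its transpose, each
  row divided by the squared norm \<open>c\<close>. Conjugation gives a diagonal matrix, whose
  characteristic polynomial is a product of linear factors, so repeated eigenvalues are counted
  correctly.\<close>

lemma proots_char_poly_eigenbasis:
  assumes E: "eigenbasis V f K \<phi> \<mu>" and vs: "distinct vs" "set vs = V"
  shows "proots (char_poly (matrix_along vs f)) = image_mset \<mu> (mset_set K)"
proof -
  define N where "N = length vs"
  obtain ks where ks: "distinct ks" "set ks = K"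
    using finite_distinct_list[OF eigenbasisD(2)[OF E]] by blast
  have lks: "length ks = N"
    using eigenbasisD(3)[OF E] distinct_card[OF vs(1)] distinct_card[OF ks(1)] vs ks N_def by simp
  have kK: "ks ! i \<in> K" if "i < N" for i using that lks ks nth_mem by metis
  have vV: "vs ! i \<in> V" if "i < N" for i using that N_def vs nth_mem by metis
  define c where "c k = (\<Sum>v\<in>V. \<phi> k v * \<phi> k v)" for k
  have c: "c k \<noteq> 0" if "k \<in> K" for k
    using eigenbasisD(5)[OF E that that] unfolding c_def by simp
  define A where "A = matrix_along vs f"
  define P where "P = mat N N (\<lambda>(i, j). \<phi> (ks ! j) (vs ! i))"
  define Q where "Q = mat N N (\<lambda>(i, j). \<phi> (ks ! i) (vs ! j) / c (ks ! i))"
  define D where "D = mat N N (\<lambda>(i, j). if i = j then \<mu> (ks ! i) else 0)"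
  have car: "A \<in> carrier_mat N N" "P \<in> carrier_mat N N" "Q \<in> carrier_mat N N"
    "D \<in> carrier_mat N N"
    unfolding A_def P_def Q_def D_def matrix_along_def N_def by auto
  have QP: "Q * P = 1\<^sub>m N"
  proof (rule eq_matI)
    fix i j assume "i < dim_row (1\<^sub>m N)" "j < dim_col (1\<^sub>m N)"
    then have ij: "i < N" "j < N" by auto
    have "(Q * P) $$ (i, j) =
        (\<Sum>l = 0..<N. \<phi> (ks ! i) (vs ! l) * \<phi> (ks ! j) (vs ! l) / c (ks ! i))"
      unfolding Q_def P_def times_mat_def scalar_prod_def using ij by simp
    also have "\<dots> = (\<Sum>v\<in>V. \<phi> (ks ! i) v * \<phi> (ks ! j) v / c (ks ! i))"
      unfolding N_def vs(2)[symmetric] by (rule sum_nth[OF vs(1)])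
    also have "\<dots> = (\<Sum>v\<in>V. \<phi> (ks ! i) v * \<phi> (ks ! j) v) / c (ks ! i)"
      by (simp add: sum_divide_distrib)
    also have "\<dots> = (if i = j then 1 else 0)"
    proof (cases "i = j")
      case True
      then show ?thesis using c[OF kK[OF ij(1)]] by (simp add: c_def)
    next
      case False
      then have "ks ! i \<noteq> ks ! j" using ij ks(1) lks by (simp add: nth_eq_iff_index_eq)
      then show ?thesis using eigenbasisD(5)[OF E kK[OF ij(1)] kK[OF ij(2)]] False by simp
    qed
    finally show "(Q * P) $$ (i, j) = 1\<^sub>m N $$ (i, j)" using ij by simp
  qed (use car in auto)
  then have PQ: "P * Q = 1\<^sub>m N"
    using mat_mult_left_right_inverse[OF car(3) car(2)] by blast
  have AP: "A * P = P * D"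
  proof (rule eq_matI)
    fix i j assume "i < dim_row (P * D)" "j < dim_col (P * D)"
    then have ij: "i < N" "j < N" using car by auto
    have "(A * P) $$ (i, j) = (\<Sum>l = 0..<N. f (vs ! i) (vs ! l) * \<phi> (ks ! j) (vs ! l))"
      unfolding A_def matrix_along_def P_def times_mat_def scalar_prod_def using ij N_def by simp
    also have "\<dots> = (\<Sum>v\<in>V. f (vs ! i) v * \<phi> (ks ! j) v)"
      unfolding N_def vs(2)[symmetric] by (rule sum_nth[OF vs(1)])
    also have "\<dots> = \<mu> (ks ! j) * \<phi> (ks ! j) (vs ! i)"
      by (rule eigenbasisD(4)[OF E kK[OF ij(2)] vV[OF ij(1)]])
    also have "\<dots> = (\<Sum>l = 0..<N. if l = j then \<phi> (ks ! l) (vs ! i) * \<mu> (ks ! l) else 0)"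
      using ij by simp
    also have "\<dots> = (\<Sum>l = 0..<N. \<phi> (ks ! l) (vs ! i) * (if l = j then \<mu> (ks ! l) else 0))"
      by (intro sum.cong) auto
    also have "\<dots> = (P * D) $$ (i, j)"
      unfolding P_def D_def times_mat_def scalar_prod_def using ij by simp
    finally show "(A * P) $$ (i, j) = (P * D) $$ (i, j)" .
  qed (use car in auto)
  have "A = A * (P * Q)" using car PQ by simp
  also have "\<dots> = A * P * Q" using car by (simp add: assoc_mult_mat)
  finally have "A = P * D * Q" unfolding AP .
  then have "similar_mat A D"
    by (intro similar_matI[OF _ PQ QP]) (use car in auto)
  then have "char_poly A = char_poly D" by (rule char_poly_similar)
  also have "\<dots> = (\<Prod>a\<leftarrow>diag_mat D. [:- a, 1:])"
    by (rule char_poly_upper_triangular[OF car(4)]) (auto simp: D_def)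
  also have "diag_mat D = map \<mu> ks"
    unfolding diag_mat_def using lks by (intro nth_equalityI) (auto simp: D_def)
  also have "(\<Prod>a\<leftarrow>map \<mu> ks. [:- a, 1:]) = (\<Prod>k\<in>K. [:- \<mu> k, 1:])"
    using prod.distinct_set_conv_list[OF ks(1), of "\<lambda>k. [:- \<mu> k, 1:]"] ks(2) by (simp add: o_def)
  finally have "proots (char_poly A) = (\<Sum>k\<in>K. proots [:- \<mu> k, 1:])"
    by (simp add: proots_prod)
  also have "\<dots> = image_mset \<mu> (mset_set K)"
    using eigenbasisD(2)[OF E]
    by (induction K rule: finite_induct) auto
  finally show ?thesis unfolding A_def .
qed

lemma eigenbasis_cong:
  assumes "eigenbasis V f K \<phi> \<mu>"
    and "\<And>u v. u \<in> V \<Longrightarrow> v \<in> V \<Longrightarrow> g u v = f u v" and "\<And>k. k \<in> K \<Longrightarrow> \<nu> k = \<mu> k"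
  shows "eigenbasis V g K \<phi> \<nu>"
  using assms unfolding eigenbasis_def by auto

text \<open>Symmetry lets the kernel move from one side of an inner product to the other, so the
  inner product times \<open>\<mu> k\<close> equals the inner product times \<open>\<mu> l\<close>;
  distinct eigenvalues force it to be 0. For k = l it is a sum of squares that are not all
  0.\<close>

lemma eigenbasis_symmetric:
  assumes "finite V" "finite K" "card K = card V" and inj: "inj_on \<mu> K"
    and sym: "\<And>u v. u \<in> V \<Longrightarrow> v \<in> V \<Longrightarrow> f u v = f v u"
    and ev: "\<And>k u. k \<in> K \<Longrightarrow> u \<in> V \<Longrightarrow> (\<Sum>v\<in>V. f u v * \<phi> k v) = \<mu> k * \<phi> k u"
    and nz: "\<And>k. k \<in> K \<Longrightarrow> \<exists>v\<in>V. \<phi> k v \<noteq> 0"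
  shows "eigenbasis V f K \<phi> \<mu>"
proof -
  have "(\<Sum>v\<in>V. \<phi> k v * \<phi> l v) = 0 \<longleftrightarrow> k \<noteq> l" if k: "k \<in> K" and l: "l \<in> K" for k l
  proof
    show "k \<noteq> l" if "(\<Sum>v\<in>V. \<phi> k v * \<phi> l v) = 0"
      using nz[OF k] that sum_nonneg_eq_0_iff[OF assms(1), of "\<lambda>v. \<phi> k v * \<phi> k v"] by auto
    assume "k \<noteq> l"
    have "\<mu> k * (\<Sum>v\<in>V. \<phi> k v * \<phi> l v) = (\<Sum>u\<in>V. (\<Sum>v\<in>V. f u v * \<phi> k v) * \<phi> l u)"
      using ev[OF k] by (simp add: sum_distrib_left mult.assoc)
    also have "\<dots> = (\<Sum>u\<in>V. \<Sum>v\<in>V. f u v * \<phi> k v * \<phi> l u)"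
      by (simp add: sum_distrib_right)
    also have "\<dots> = (\<Sum>v\<in>V. \<Sum>u\<in>V. f u v * \<phi> k v * \<phi> l u)"
      by (rule sum.swap)
    also have "\<dots> = (\<Sum>v\<in>V. \<phi> k v * (\<Sum>u\<in>V. f v u * \<phi> l u))"
      by (intro sum.cong refl) (simp add: sum_distrib_left sym ac_simps)
    also have "\<dots> = \<mu> l * (\<Sum>v\<in>V. \<phi> k v * \<phi> l v)"
      using ev[OF l] by (simp add: sum_distrib_left ac_simps)
    finally show "(\<Sum>v\<in>V. \<phi> k v * \<phi> l v) = 0"
      using inj_onD[OF inj _ k l] \<open>k \<noteq> l\<close> by auto
  qed
  then show ?thesis unfolding eigenbasis_def using assms by auto
qed

section \<open>Switching equivalence\<close>

definition switching_equivalent ::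
  "'v set \<Rightarrow> ('v \<Rightarrow> 'v \<Rightarrow> real) \<Rightarrow> 'i set \<Rightarrow> ('i \<Rightarrow> 'i \<Rightarrow> real) \<Rightarrow> bool" where
  "switching_equivalent V g I h \<longleftrightarrow> (\<exists>F s. bij_betw F I V \<and> (\<forall>i\<in>I. s i * s i = 1) \<and>
     (\<forall>i\<in>I. \<forall>j\<in>I. g (F i) (F j) = s i * h i j * s j))"

lemma switching_equivalentE:
  assumes "switching_equivalent V g I h"
  obtains F and s :: "'i \<Rightarrow> real" where "bij_betw F I V" and "\<And>i. i \<in> I \<Longrightarrow> s i * s i = 1"
    and "\<And>i j. i \<in> I \<Longrightarrow> j \<in> I \<Longrightarrow> g (F i) (F j) = s i * h i j * s j"
  using assms unfolding switching_equivalent_def by blast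

text \<open>Eigenvectors are transported along \<open>F\<close> and multiplied by the signs
  \<open>s\<close>. In the row sums and in the inner products every sign meets itself and cancels by
  \<open>s j * s j = 1\<close>.\<close>

lemma eigenbasis_switching:
  assumes sw: "switching_equivalent V g I h" and E: "eigenbasis I h K \<phi> \<mu>"
  obtains \<psi> where "eigenbasis V g K \<psi> \<mu>"
proof -
  obtain F s where F: "bij_betw F I V" and s: "\<And>i. i \<in> I \<Longrightarrow> s i * s i = (1::real)"
    and g: "\<And>i j. i \<in> I \<Longrightarrow> j \<in> I \<Longrightarrow> g (F i) (F j) = s i * h i j * s j"
    using switching_equivalentE[OF sw] by metis
  have inv: "the_inv_into I F (F i) = i" if "i \<in> I" for i
    using F that by (simp add: bij_betw_def the_inv_into_f_f)
  have im: "V = F ` I" using F by (simp add: bij_betw_def)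
  have re: "(\<Sum>v\<in>V. x v) = (\<Sum>i\<in>I. x (F i))" for x :: "_ \<Rightarrow> real"
    by (rule sum.reindex_bij_betw[OF F, symmetric])
  have "(\<Sum>j\<in>I. g (F i) (F j) * (s j * \<phi> k j)) = \<mu> k * (s i * \<phi> k i)"
    if "k \<in> K" "i \<in> I" for k i
  proof -
    have "(\<Sum>j\<in>I. g (F i) (F j) * (s j * \<phi> k j)) = (\<Sum>j\<in>I. s i * (h i j * \<phi> k j) * (s j * s j))"
      by (intro sum.cong) (auto simp: g that)
    also have "\<dots> = s i * (\<Sum>j\<in>I. h i j * \<phi> k j)"
      by (simp add: s sum_distrib_left)
    finally show ?thesis using eigenbasisD(4)[OF E that] by simp
  qed
  moreover have "(\<Sum>i\<in>I. s i * \<phi> k i * (s i * \<phi> l i)) = (\<Sum>i\<in>I. \<phi> k i * \<phi> l i)" for k l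
  proof (intro sum.cong refl)
    fix i assume "i \<in> I"
    then show "s i * \<phi> k i * (s i * \<phi> l i) = \<phi> k i * \<phi> l i"
      using s[of i] by (metis (no_types, lifting) mult.assoc mult.commute mult_1)
  qed
  ultimately have "eigenbasis V g K
      (\<lambda>k v. s (the_inv_into I F v) * \<phi> k (the_inv_into I F v)) \<mu>"
    using E bij_betw_finite[OF F] bij_betw_same_card[OF F]
    unfolding eigenbasis_def re by (auto simp: inv im)
  then show thesis by (rule that)
qed

section \<open>Kronecker sums and Laplacian kernels\<close>

definition kron_sum ::
  "('a \<Rightarrow> 'a \<Rightarrow> real) \<Rightarrow> ('b \<Rightarrow> 'b \<Rightarrow> real) \<Rightarrow> 'a \<times> 'b \<Rightarrow> 'a \<times> 'b \<Rightarrow> real" where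
  "kron_sum f g p q = (if snd p = snd q then f (fst p) (fst q) else 0) +
     (if fst p = fst q then g (snd p) (snd q) else 0)"

text \<open>The function \<open>x\<close> is arbitrary because of two uses: a product of
  eigenvectors yields the eigenvalue equation, and the constant 1 with absolute kernels yields the
  row sums behind the degrees.\<close>

lemma sum_kron_sum:
  fixes x :: "'a \<Rightarrow> 'b \<Rightarrow> real"
  assumes "finite V" "finite W" "u \<in> V" "v \<in> W"
  shows "(\<Sum>p\<in>V \<times> W. (if v = snd p then f u (fst p) * x (fst p) (snd p) else 0) +
      (if u = fst p then g v (snd p) * x (fst p) (snd p) else 0)) =
    (\<Sum>a\<in>V. f u a * x a v) + (\<Sum>b\<in>W. g v b * x u b)"
proof -
  have "(\<Sum>p\<in>V \<times> W. if v = snd p then f u (fst p) * x (fst p) (snd p) else 0) =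
      (\<Sum>a\<in>V. \<Sum>b\<in>W. if v = b then f u a * x a b else 0)"
    by (simp add: sum.cartesian_product split_beta)
  moreover have "(\<Sum>p\<in>V \<times> W. if u = fst p then g v (snd p) * x (fst p) (snd p) else 0) =
      (\<Sum>a\<in>V. \<Sum>b\<in>W. if u = a then g v b * x a b else 0)"
    by (simp add: sum.cartesian_product split_beta)
  moreover have "\<dots> = (\<Sum>a\<in>V. if u = a then \<Sum>b\<in>W. g v b * x a b else 0)"
    by (intro sum.cong) auto
  ultimately show ?thesis using assms by (simp add: sum.distrib)
qed

text \<open>The inner product of two product vectors is the product of the inner products in the
  factors, so it vanishes exactly when at least one of the two indices differs.\<close>

lemma eigenbasis_kron_sum:
  assumes E: "eigenbasis V f K \<phi> \<mu>" and E': "eigenbasis W g L \<psi> \<nu>"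
  shows "eigenbasis (V \<times> W) (kron_sum f g) (K \<times> L) (\<lambda>(k, l) (u, v). \<phi> k u * \<psi> l v)
    (\<lambda>(k, l). \<mu> k + \<nu> l)"
proof -
  note fin = eigenbasisD(1)[OF E] eigenbasisD(1)[OF E']
  have "(\<Sum>p\<in>V \<times> W. kron_sum f g (u, v) p * (\<phi> k (fst p) * \<psi> l (snd p))) =
      (\<mu> k + \<nu> l) * (\<phi> k u * \<psi> l v)" if "k \<in> K" "l \<in> L" "u \<in> V" "v \<in> W" for k l u v
  proof -
    have "(\<Sum>p\<in>V \<times> W. kron_sum f g (u, v) p * (\<phi> k (fst p) * \<psi> l (snd p))) =
      (\<Sum>a\<in>V. f u a * (\<phi> k a * \<psi> l v)) + (\<Sum>b\<in>W. g v b * (\<phi> k u * \<psi> l b))"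
      unfolding sum_kron_sum[OF fin that(3,4), of f "\<lambda>a b. \<phi> k a * \<psi> l b" g, symmetric]
      by (intro sum.cong) (auto simp: kron_sum_def algebra_simps)
    also have "\<dots> = (\<Sum>a\<in>V. f u a * \<phi> k a) * \<psi> l v + \<phi> k u * (\<Sum>b\<in>W. g v b * \<psi> l b)"
      by (simp add: sum_distrib_left sum_distrib_right ac_simps)
    finally show ?thesis
      using eigenbasisD(4)[OF E that(1,3)] eigenbasisD(4)[OF E' that(2,4)]
      by (simp add: algebra_simps)
  qed
  moreover have "(\<Sum>p\<in>V \<times> W. \<phi> k (fst p) * \<psi> l (snd p) * (\<phi> k' (fst p) * \<psi> l' (snd p))) =
      (\<Sum>u\<in>V. \<phi> k u * \<phi> k' u) * (\<Sum>v\<in>W. \<psi> l v * \<psi> l' v)" for k k' l l'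
    by (simp add: sum_product sum.cartesian_product split_beta ac_simps)
  ultimately show ?thesis
    using E E' unfolding eigenbasis_def by (auto simp: split_beta card_cartesian_product)
qed

definition laplacian_kernel :: "'v set \<Rightarrow> ('v \<Rightarrow> 'v \<Rightarrow> real) \<Rightarrow> 'v \<Rightarrow> 'v \<Rightarrow> real" where
  "laplacian_kernel V g u v = (if u = v then \<Sum>w\<in>V. \<bar>g u w\<bar> else 0) - g u v"

text \<open>Both conditions in \<open>kron_sum\<close> hold together only at the diagonal position,
  where the zero diagonals kill both terms. Everywhere else at most one term is present, so the
  absolute value splits.\<close>

lemma sum_abs_kron_sum:
  assumes "finite V" "finite W" "u \<in> V" "v \<in> W" and "f u u = 0" and "g v v = 0"
  shows "(\<Sum>p\<in>V \<times> W. \<bar>kron_sum f g (u, v) p\<bar>) = (\<Sum>a\<in>V. \<bar>f u a\<bar>) + (\<Sum>b\<in>W. \<bar>g v b\<bar>)"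
proof -
  have "(\<Sum>p\<in>V \<times> W. \<bar>kron_sum f g (u, v) p\<bar>) =
     (\<Sum>p\<in>V \<times> W. (if v = snd p then \<bar>f u (fst p)\<bar> * 1 else 0) +
      (if u = fst p then \<bar>g v (snd p)\<bar> * 1 else 0))"
    using assms(5,6) by (intro sum.cong) (auto simp: kron_sum_def)
  also have "\<dots> = (\<Sum>a\<in>V. \<bar>f u a\<bar>) + (\<Sum>b\<in>W. \<bar>g v b\<bar>)"
    using sum_kron_sum[OF assms(1-4), of "\<lambda>a b. \<bar>f a b\<bar>" "\<lambda>_ _. 1" "\<lambda>a b. \<bar>g a b\<bar>"] by simp
  finally show ?thesis .
qed

lemma laplacian_kernel_kron_sum:
  assumes "finite V" "finite W" "p \<in> V \<times> W"
    and "\<And>u. u \<in> V \<Longrightarrow> f u u = 0" and "\<And>v. v \<in> W \<Longrightarrow> g v v = 0"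
  shows "laplacian_kernel (V \<times> W) (kron_sum f g) p q =
    kron_sum (laplacian_kernel V f) (laplacian_kernel W g) p q"
proof -
  obtain u v where p: "p = (u, v)" "u \<in> V" "v \<in> W" using assms(3) by auto
  show ?thesis
    using sum_abs_kron_sum[of V W u v f g] assms p
    by (cases q) (auto simp: laplacian_kernel_def kron_sum_def[of "laplacian_kernel V f"]
        kron_sum_def[of f g "(u, v)" "(_, _)"])
qed

lemma sum_abs_switching:
  fixes s :: "'i \<Rightarrow> real"
  assumes F: "bij_betw F I V" and s: "\<And>i. i \<in> I \<Longrightarrow> s i * s i = 1"
    and g: "\<And>i j. i \<in> I \<Longrightarrow> j \<in> I \<Longrightarrow> g (F i) (F j) = s i * h i j * s j"
    and i: "i \<in> I"
  shows "(\<Sum>w\<in>V. \<bar>g (F i) w\<bar>) = (\<Sum>j\<in>I. \<bar>h i j\<bar>)"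
proof -
  have abs_s: "\<bar>s i\<bar> = 1" if "i \<in> I" for i
    using s[OF that] abs_square_eq_1[of "s i"] by (simp add: power2_eq_square)
  have "(\<Sum>w\<in>V. \<bar>g (F i) w\<bar>) = (\<Sum>j\<in>I. \<bar>g (F i) (F j)\<bar>)"
    by (rule sum.reindex_bij_betw[OF F, symmetric])
  also have "\<dots> = (\<Sum>j\<in>I. \<bar>h i j\<bar>)"
    by (intro sum.cong) (auto simp: g abs_mult abs_s i)
  finally show ?thesis .
qed

lemma sum_sum_abs_switching:
  assumes "switching_equivalent V g I h"
  shows "(\<Sum>u\<in>V. \<Sum>w\<in>V. \<bar>g u w\<bar>) = (\<Sum>i\<in>I. \<Sum>j\<in>I. \<bar>h i j\<bar>)"
proof -
  obtain F s where F: "bij_betw F I V" and s: "\<And>i. i \<in> I \<Longrightarrow> s i * s i = (1::real)"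
    and g: "\<And>i j. i \<in> I \<Longrightarrow> j \<in> I \<Longrightarrow> g (F i) (F j) = s i * h i j * s j"
    using switching_equivalentE[OF assms] by metis
  have "(\<Sum>u\<in>V. \<Sum>w\<in>V. \<bar>g u w\<bar>) = (\<Sum>i\<in>I. \<Sum>w\<in>V. \<bar>g (F i) w\<bar>)"
    by (rule sum.reindex_bij_betw[OF F, symmetric])
  then show ?thesis using sum_abs_switching[where g = g, OF F s g] by simp
qed

text \<open>The degree terms are absolute row sums, which do not see signs; they stand on the
  diagonal, where the switching factor \<open>s i * s i\<close> is 1.\<close>

lemma switching_equivalent_laplacian_kernel:
  assumes "switching_equivalent V g I h"
  shows "switching_equivalent V (laplacian_kernel V g) I (laplacian_kernel I h)"
proof -
  obtain F s where F: "bij_betw F I V" and s: "\<And>i. i \<in> I \<Longrightarrow> s i * s i = (1::real)"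
    and g: "\<And>i j. i \<in> I \<Longrightarrow> j \<in> I \<Longrightarrow> g (F i) (F j) = s i * h i j * s j"
    using switching_equivalentE[OF assms] by metis
  have "laplacian_kernel V g (F i) (F j) = s i * laplacian_kernel I h i j * s j"
    if "i \<in> I" "j \<in> I" for i j
  proof -
    have "F i = F j \<longleftrightarrow> i = j"
      using F that by (auto simp: bij_betw_def dest: inj_onD)
    then show ?thesis
      using s[OF that(2)] sum_abs_switching[where g = g, OF F s g that(1)]
      by (auto simp: laplacian_kernel_def g that algebra_simps)
  qed
  then show ?thesis unfolding switching_equivalent_def using F s by blast
qed

section \<open>Signed graphs through their adjacency kernels\<close>

definition adj :: "'a sgraph \<Rightarrow> 'a \<Rightarrow> 'a \<Rightarrow> real" where
  "adj S u v = (if {u, v} \<in> edges S then real_of_int (esign S {u, v}) else 0)"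

lemma adj_self: "signed_graph S \<Longrightarrow> adj S u u = 0"
  unfolding adj_def signed_graph_def by fastforce

lemma adj_commute: "adj S u v = adj S v u"
  by (simp add: adj_def insert_commute)

lemma abs_adj: "signed_graph S \<Longrightarrow> \<bar>adj S u v\<bar> = (if {u, v} \<in> edges S then 1 else 0)"
  unfolding adj_def signed_graph_def by fastforce

text \<open>An edge at \<open>u\<close> is determined by its other end, so edges at \<open>u\<close>
  correspond to neighbours, each of which contributes 1 to the absolute row sum.\<close>

lemma vertex_degree_adj:
  assumes S: "signed_graph S"
  shows "real (vertex_degree S u) = (\<Sum>v\<in>verts S. \<bar>adj S u v\<bar>)"
proof -
  have "bij_betw (\<lambda>v. {u, v}) {v \<in> verts S. {u, v} \<in> edges S} {e \<in> edges S. u \<in> e}"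
  proof (rule bij_betwI')
    fix e assume "e \<in> {e \<in> edges S. u \<in> e}"
    then have e: "e \<in> edges S" "u \<in> e" "card e = 2" "e \<subseteq> verts S"
      using S unfolding signed_graph_def by auto
    from e(3) obtain a b where "e = {a, b}" "a \<noteq> b" by (auto simp: card_2_iff)
    then show "\<exists>v\<in>{v \<in> verts S. {u, v} \<in> edges S}. e = {u, v}"
      using e by (auto simp: insert_commute)
  qed (auto simp: doubleton_eq_iff)
  from bij_betw_same_card[OF this]
  have "real (vertex_degree S u) = real (card {v \<in> verts S. {u, v} \<in> edges S})"
    by (simp add: vertex_degree_def)
  also have "\<dots> = (\<Sum>v\<in>verts S. if {u, v} \<in> edges S then 1 else 0)"
    using S by (simp add: signed_graph_def sum.If_cases Int_def)
  finally show ?thesis by (simp add: abs_adj[OF S])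
qed

lemma eigenvalues_eigenbasis:
  assumes "signed_graph S" "eigenbasis (verts S) (adj S) K \<phi> \<mu>"
  shows "eigenvalues S = image_mset \<mu> (mset_set K)"
proof -
  have "adjacency_matrix S = matrix_along (vertex_list S) (adj S)"
    by (simp add: adjacency_matrix_def adj_def[abs_def])
  then show ?thesis
    using proots_char_poly_eigenbasis[OF assms(2)] vertex_list[of S] assms(1)
    by (simp add: eigenvalues_def signed_graph_def)
qed

lemma laplacian_eigenvalues_eigenbasis:
  assumes "signed_graph S" "eigenbasis (verts S) (laplacian_kernel (verts S) (adj S)) K \<phi> \<mu>"
  shows "laplacian_eigenvalues S = image_mset \<mu> (mset_set K)"
proof -
  have "laplacian_matrix S =
      matrix_along (vertex_list S) (laplacian_kernel (verts S) (adj S))"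
    unfolding laplacian_matrix_def degree_matrix_def adjacency_matrix_def
      laplacian_kernel_def[abs_def] vertex_degree_adj[OF assms(1)] adj_def[symmetric]
    by (rule eq_matI) (auto simp: matrix_along_def)
  then show ?thesis
    using proots_char_poly_eigenbasis[OF assms(2)] vertex_list[of S] assms(1)
    by (simp add: laplacian_eigenvalues_def signed_graph_def)
qed

lemma handshake:
  assumes S: "signed_graph S"
  shows "2 * real (card (edges S)) = (\<Sum>u\<in>verts S. \<Sum>v\<in>verts S. \<bar>adj S u v\<bar>)"
proof -
  have V: "finite (verts S)" and "edges S \<subseteq> Pow (verts S)"
    using S by (auto simp: signed_graph_def)
  then have E: "finite (edges S)" by (meson finite_Pow_iff finite_subset)
  have "card {u \<in> verts S. u \<in> e} = 2" if "e \<in> edges S" for e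
  proof -
    have "{u \<in> verts S. u \<in> e} = e" "card e = 2"
      using S that by (auto simp: signed_graph_def)
    then show ?thesis by simp
  qed
  then have "(\<Sum>u\<in>verts S. vertex_degree S u) = 2 * card (edges S)"
    unfolding vertex_degree_def by (intro sum_multicount[OF V E]) auto
  then have "real (2 * card (edges S)) = (\<Sum>u\<in>verts S. real (vertex_degree S u))"
    by (metis of_nat_sum)
  then show ?thesis by (simp add: vertex_degree_adj[OF S])
qed

section \<open>Cartesian products of signed graphs\<close>

lemma doubleton_pair_eq_iff:
  "{(a, b), (c, d)} = {(a', b'), (c', d')} \<longleftrightarrow>
    (a = a' \<and> b = b' \<and> c = c' \<and> d = d') \<or> (a = c' \<and> b = d' \<and> c = a' \<and> d = b')"
  by (auto simp: doubleton_eq_iff)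

lemma cartesian_product_edge_iff:
  assumes "u \<in> verts S" "v \<in> verts T"
  shows "{(u, v), (u', v')} \<in> edges (cartesian_product S T) \<longleftrightarrow>
    (v = v' \<and> {u, u'} \<in> edges S) \<or> (u = u' \<and> {v, v'} \<in> edges T)"
proof
  show "{(u, v), (u', v')} \<in> edges (cartesian_product S T)"
    if "(v = v' \<and> {u, u'} \<in> edges S) \<or> (u = u' \<and> {v, v'} \<in> edges T)"
    using assms that unfolding cartesian_product_def by auto
qed (auto simp: cartesian_product_def doubleton_pair_eq_iff insert_commute)

lemma signed_graph_doubleton:
  assumes "signed_graph S" "{u, u'} \<in> edges S"
  shows "u \<noteq> u'" "u \<in> verts S" "u' \<in> verts S"
  using assms unfolding signed_graph_def by fastforce+

lemma signed_graph_cartesian_product: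
  assumes S: "signed_graph S" and T: "signed_graph T"
  shows "signed_graph (cartesian_product S T)"
proof -
  have *: "e \<subseteq> verts S \<times> verts T \<and> card e = 2 \<and> esign (cartesian_product S T) e \<in> {1, -1}"
    if "e \<in> edges (cartesian_product S T)" for e
  proof -
    from that consider (S) u u' v where "e = {(u, v), (u', v)}" "{u, u'} \<in> edges S" "v \<in> verts T"
      | (T) u v v' where "e = {(u, v), (u, v')}" "u \<in> verts S" "{v, v'} \<in> edges T"
      by (auto simp: cartesian_product_def)
    then show ?thesis
    proof cases
      case S
      have "esign S {u, u'} \<in> {1, -1}" using S(2) assms(1) unfolding signed_graph_def by blast
      then show ?thesis
        using S signed_graph_doubleton[OF assms(1) S(2)] by (auto simp: cartesian_product_def)
    next
      case T
      have "esign T {v, v'} \<in> {1, -1}" using T(3) assms(2) unfolding signed_graph_def by blast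
      \<comment> \<open>The first projection of an edge along the second factor is
        \<open>{u}\<close>; as this is no edge of \<open>S\<close>, the sign is taken from
        \<open>T\<close>.\<close>
      moreover have "{u} \<notin> edges S" using assms(1) unfolding signed_graph_def by fastforce
      ultimately show ?thesis
        using T signed_graph_doubleton[OF assms(2) T(3)] by (auto simp: cartesian_product_def)
    qed
  qed
  moreover have "finite (verts (cartesian_product S T))"
    using S T by (simp add: cartesian_product_def signed_graph_def)
  moreover have "verts (cartesian_product S T) = verts S \<times> verts T"
    by (simp add: cartesian_product_def)
  ultimately show ?thesis unfolding signed_graph_def by auto
qed

lemma adj_cartesian_product:
  assumes S: "signed_graph S" and T: "signed_graph T"
    and p: "p \<in> verts S \<times> verts T"
  shows "adj (cartesian_product S T) p q = kron_sum (adj S) (adj T) p q"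
proof -
  obtain u v u' v' where pq: "p = (u, v)" "q = (u', v')" "u \<in> verts S" "v \<in> verts T"
    using p by (cases q) auto
  \<comment> \<open>Without loops at most one term of the Kronecker sum is nonzero, and the test on
    the first projection selects the matching factor.\<close>
  have noloop: "{w} \<notin> edges S" "{x} \<notin> edges T" for w x
    using S T unfolding signed_graph_def by fastforce+
  show ?thesis
    unfolding pq adj_def cartesian_product_edge_iff[OF pq(3,4)]
    using noloop by (auto simp: kron_sum_def adj_def cartesian_product_def)
qed

section \<open>Paths and cycles\<close>

lemma sum_laplacian_kernel:
  fixes x :: "'v \<Rightarrow> real"
  assumes "finite V" "u \<in> V"
  shows "(\<Sum>v\<in>V. laplacian_kernel V g u v * x v) = (\<Sum>w\<in>V. \<bar>g u w\<bar>) * x u - (\<Sum>v\<in>V. g u v * x v)"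
proof -
  have "(\<Sum>v\<in>V. laplacian_kernel V g u v * x v) =
      (\<Sum>v\<in>V. (if v = u then (\<Sum>w\<in>V. \<bar>g u w\<bar>) * x v else 0) - g u v * x v)"
    unfolding laplacian_kernel_def by (intro sum.cong) (auto simp: algebra_simps)
  then show ?thesis using assms by (simp add: sum_subtractf)
qed

lemma laplacian_kernel_commute:
  assumes "\<And>u v. g u v = g v u"
  shows "laplacian_kernel V g u v = laplacian_kernel V g v u"
  using assms[of u v] by (simp add: laplacian_kernel_def)

section \<open>Eigenbases of the all-positive path\<close>

definition path_kernel :: "nat \<Rightarrow> nat \<Rightarrow> real" where
  "path_kernel i j = (if j = Suc i \<or> i = Suc j then 1 else 0)"

lemma path_kernel_commute: "path_kernel i j = path_kernel j i"
  by (auto simp: path_kernel_def)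

lemma sum_path_kernel:
  fixes x :: "nat \<Rightarrow> real"
  assumes "i < n"
  shows "(\<Sum>j<n. path_kernel i j * x j) =
    (if 0 < i then x (i - 1) else 0) + (if Suc i < n then x (Suc i) else 0)"
proof -
  \<comment> \<open>For i = 0 the truncated \<open>i - 1\<close> is 0 again, not a neighbour; the
    inner test \<open>0 < i\<close> removes that term.\<close>
  have "(\<Sum>j<n. path_kernel i j * x j) =
      (\<Sum>j<n. (if j = i - 1 then if 0 < i then x j else 0 else 0) + (if j = Suc i then x j else 0))"
    by (intro sum.cong) (auto simp: path_kernel_def)
  also have "\<dots> = (\<Sum>j<n. if j = i - 1 then if 0 < i then x j else 0 else 0) +
      (\<Sum>j<n. if j = Suc i then x j else 0)"
    by (rule sum.distrib)
  finally show ?thesis using assms by (simp add: less_imp_diff_less)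
qed

lemma sum_abs_path_kernel:
  assumes "i < n"
  shows "(\<Sum>j<n. \<bar>path_kernel i j\<bar>) = (if 0 < i then 1 else 0) + (if Suc i < n then 1 else 0)"
proof -
  have "\<bar>path_kernel i j\<bar> = path_kernel i j * 1" for j by (simp add: path_kernel_def)
  then show ?thesis using sum_path_kernel[OF assms, of "\<lambda>_. 1"] by simp
qed

lemma sin_three_term: "sin (x - y) + sin (x + y) = 2 * cos y * sin (x::real)"
  by (simp add: sin_add sin_diff)

lemma cos_three_term: "cos (x - y) + cos (x + y) = 2 * cos y * cos (x::real)"
  by (simp add: cos_add cos_diff)

text \<open>The sine vanishes at the two virtual positions 0 and n + 1 beyond the ends, so the
  three-term identity needs no correction there. The angles lie strictly between 0 and pi, where cos
  is injective and the first entry of the eigenvector is positive.\<close>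

lemma eigenbasis_path_kernel:
  "eigenbasis {..<n} path_kernel {1..n}
    (\<lambda>j t. sin (real j * pi / real (n + 1) * real (t + 1)))
    (\<lambda>j. 2 * cos (real j * pi / real (n + 1)))"
proof (rule eigenbasis_symmetric)
  have rng: "0 < real j * pi / real (n + 1)" "real j * pi / real (n + 1) < pi"
    if "j \<in> {1..n}" for j
  proof -
    have "real j * pi < real (n + 1) * pi"
      using that by (intro mult_strict_right_mono) auto
    then show "0 < real j * pi / real (n + 1)" "real j * pi / real (n + 1) < pi"
      using that by (auto simp: pos_divide_less_eq mult.commute)
  qed
  show "inj_on (\<lambda>j. 2 * cos (real j * pi / real (n + 1))) {1..n}"
  proof (rule inj_onI)
    fix i j assume ij: "i \<in> {1..n}" "j \<in> {1..n}"
      and "2 * cos (real i * pi / real (n + 1)) = 2 * cos (real j * pi / real (n + 1))"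
    then have "cos (real i * pi / real (n + 1)) = cos (real j * pi / real (n + 1))" by simp
    then have "real i * pi / real (n + 1) = real j * pi / real (n + 1)"
      using cos_inj_pi rng[OF ij(1)] rng[OF ij(2)] by (meson less_imp_le)
    then show "i = j" by simp
  qed
  fix j assume j: "j \<in> {1..n}"
  define \<theta> where "\<theta> = real j * pi / real (n + 1)"
  show "\<exists>t\<in>{..<n}. sin (real j * pi / real (n + 1) * real (t + 1)) \<noteq> 0"
    using sin_gt_zero[OF rng[OF j]] j by (intro bexI[of _ 0]) auto
  fix t assume t: "t \<in> {..<n}"
  \<comment> \<open>Vertex t stands at position t + 1, so the missing right neighbour of the last
    vertex is at position n + 1.\<close>
  have "sin (\<theta> * real (n + 1)) = sin (real j * pi)" by (simp add: \<theta>_def)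
  then have "t + 1 = n \<Longrightarrow> sin (\<theta> * real (t + 2)) = 0" by auto
  then have "(\<Sum>v<n. path_kernel t v * sin (\<theta> * real (v + 1))) =
      sin (\<theta> * real (t + 1) - \<theta>) + sin (\<theta> * real (t + 1) + \<theta>)"
    using t by (cases "t + 1 = n") (auto simp: sum_path_kernel of_nat_diff algebra_simps)
  also have "\<dots> = 2 * cos \<theta> * sin (\<theta> * real (t + 1))"
    by (rule sin_three_term)
  finally show "(\<Sum>v\<in>{..<n}. path_kernel t v * sin (real j * pi / real (n + 1) * real (v + 1))) =
      2 * cos (real j * pi / real (n + 1)) * sin (real j * pi / real (n + 1) * real (t + 1))"
    unfolding \<theta>_def .
qed (auto simp: path_kernel_commute)

text \<open>The reflected angle pi - j pi / n turns 2 - 2 cos \<theta> into the required form and is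
  0 at j = n. The shift by 1/2 centres the reflection symmetry midway between an end vertex and its
  virtual neighbour.\<close>

lemma eigenbasis_laplacian_path_kernel:
  "eigenbasis {..<n} (laplacian_kernel {..<n} path_kernel) {1..n}
    (\<lambda>j t. cos ((pi - real j * pi / real n) * (real t + 1 / 2)))
    (\<lambda>j. 2 + 2 * cos (real j * pi / real n))"
proof (rule eigenbasis_symmetric)
  have rng: "0 < real j * pi / real n" "real j * pi / real n \<le> pi"
    if "j \<in> {1..n}" for j
    using that by (auto simp: field_simps)
  show "inj_on (\<lambda>j. 2 + 2 * cos (real j * pi / real n)) {1..n}"
  proof (rule inj_onI)
    fix i j assume ij: "i \<in> {1..n}" "j \<in> {1..n}"
      and "2 + 2 * cos (real i * pi / real n) = 2 + 2 * cos (real j * pi / real n)"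
    then have "cos (real i * pi / real n) = cos (real j * pi / real n)" by simp
    then have "real i * pi / real n = real j * pi / real n"
      using cos_inj_pi rng[OF ij(1)] rng[OF ij(2)] by (meson less_imp_le)
    then show "i = j" using ij by simp
  qed
  fix j assume j: "j \<in> {1..n}"
  define \<theta> where "\<theta> = pi - real j * pi / real n"
  \<comment> \<open>The first entry shows that the eigenvector is nonzero: since j \<ge> 1 gives
    \<theta> < pi, half of \<theta> stays below pi / 2.\<close>
  have "cos (\<theta> * (real 0 + 1 / 2)) > 0"
  proof (rule cos_gt_zero_pi)
    have "0 \<le> \<theta>" "\<theta> < pi" using rng[OF j] by (auto simp: \<theta>_def)
    then show "- (pi / 2) < \<theta> * (real 0 + 1 / 2)" "\<theta> * (real 0 + 1 / 2) < pi / 2"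
      using pi_gt_zero by simp_all
  qed
  then show "\<exists>t\<in>{..<n}. cos ((pi - real j * pi / real n) * (real t + 1 / 2)) \<noteq> 0"
    using j unfolding \<theta>_def by (intro bexI[of _ 0]) auto
  fix t assume t: "t \<in> {..<n}"
  \<comment> \<open>\<open>Y\<close> extends the eigenvector past both ends with \<open>Y (- 1) = Y 0\<close> and \<open>Y n = Y (n - 1)\<close>,
    so the three-term recurrence also covers the end vertices, of degree less than 2.\<close>
  define Y where "Y x = cos (\<theta> * (x + 1 / 2))" for x
  have Y0: "Y (- 1) = Y 0"
    using cos_minus[of "\<theta> / 2"] by (simp add: Y_def)
  \<comment> \<open>An integer multiple of pi is a centre of symmetry of cos; reflecting there
    exchanges positions n and n - 1.\<close>
  have \<theta>n: "\<theta> * real n = real (n - j) * pi"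
    using j by (auto simp: \<theta>_def field_simps of_nat_diff)
  have "Y (real n) = cos (real (n - j) * pi + \<theta> / 2)"
    unfolding Y_def \<theta>n[symmetric] by (simp add: algebra_simps)
  also have "\<dots> = cos (real (n - j) * pi - \<theta> / 2)"
    by (simp add: cos_add cos_diff)
  also have "\<dots> = Y (real n - 1)"
    unfolding Y_def \<theta>n[symmetric] by (simp add: algebra_simps)
  finally have Yn: "Y (real n) = Y (real n - 1)" .
  have "(\<Sum>v<n. laplacian_kernel {..<n} path_kernel t v * Y (real v)) =
      ((if 0 < t then 1 else 0) + (if Suc t < n then 1 else 0)) * Y (real t) -
      ((if 0 < t then Y (real (t - 1)) else 0) + (if Suc t < n then Y (real (Suc t)) else 0))"
    using t by (simp add: sum_laplacian_kernel sum_path_kernel sum_abs_path_kernel)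
  also have "\<dots> = ((if 0 < t then 1 else 0) + (if Suc t < n then 1 else 0)) * Y (real t) -
      ((if 0 < t then Y (real t - 1) else 0) + (if Suc t < n then Y (real t + 1) else 0))"
    by (simp add: of_nat_diff add.commute)
  also have "\<dots> = 2 * Y (real t) - (Y (real t - 1) + Y (real t + 1))"
  proof -
    have "t = 0 \<Longrightarrow> Y (real t - 1) = Y (real t)" using Y0 by simp
    moreover have "Y (real t + 1) = Y (real t)" if "Suc t = n"
    proof -
      have "real n = real t + 1" using that by auto
      then show ?thesis using Yn by simp
    qed
    moreover have "Suc t < n \<or> Suc t = n" using t by auto
    ultimately show ?thesis by (auto simp: algebra_simps)
  qed
  also have "Y (real t - 1) + Y (real t + 1) = 2 * cos \<theta> * Y (real t)"
    using cos_three_term[of "\<theta> * (real t + 1 / 2)" \<theta>] by (simp add: Y_def algebra_simps)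
  also have "2 * Y (real t) - 2 * cos \<theta> * Y (real t) = (2 - 2 * cos \<theta>) * Y (real t)"
    by (simp add: algebra_simps)
  also have "cos \<theta> = - cos (real j * pi / real n)"
    by (simp add: \<theta>_def cos_diff)
  finally show "(\<Sum>v\<in>{..<n}. laplacian_kernel {..<n} path_kernel t v *
      cos ((pi - real j * pi / real n) * (real v + 1 / 2))) =
    (2 + 2 * cos (real j * pi / real n)) * cos ((pi - real j * pi / real n) * (real t + 1 / 2))"
    by (simp add: Y_def \<theta>_def)
qed (auto intro: laplacian_kernel_commute path_kernel_commute)

section \<open>Eigenbases of the cycle with one weighted edge\<close>

definition cycle_kernel :: "nat \<Rightarrow> real \<Rightarrow> nat \<Rightarrow> nat \<Rightarrow> real" where
  "cycle_kernel m e i j = (if i = 0 \<and> j = m - 1 \<or> i = m - 1 \<and> j = 0 then e else path_kernel i j)"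

text \<open>With m \<ge> 3 the closing edge between 0 and m - 1 is none of the path edges, so its
  weight is simply an additional term in the rows of its two ends.\<close>

lemma sum_cycle_kernel:
  fixes x :: "nat \<Rightarrow> real"
  assumes "i < m" "m \<ge> 3"
  shows "(\<Sum>j<m. cycle_kernel m e i j * x j) =
    (if i = 0 then e * x (m - 1) else x (i - 1)) + (if Suc i = m then e * x 0 else x (Suc i))"
proof -
  have "(\<Sum>j<m. cycle_kernel m e i j * x j) = (\<Sum>j<m. path_kernel i j * x j +
     ((if j = m - 1 then if i = 0 then e * x j else 0 else 0) +
      (if j = 0 then if i = m - 1 then e * x j else 0 else 0)))"
    using assms by (intro sum.cong) (auto simp: path_kernel_def cycle_kernel_def)
  also have "\<dots> = (\<Sum>j<m. path_kernel i j * x j) +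
     ((\<Sum>j<m. if j = m - 1 then if i = 0 then e * x j else 0 else 0) +
      (\<Sum>j<m. if j = 0 then if i = m - 1 then e * x j else 0 else 0))"
    by (simp only: sum.distrib)
  finally show ?thesis using assms by (auto simp: sum_path_kernel)
qed

lemma sum_abs_cycle_kernel:
  assumes "i < m" "m \<ge> 3" "\<bar>e\<bar> = 1"
  shows "(\<Sum>j<m. \<bar>cycle_kernel m e i j\<bar>) = 2"
proof -
  have "\<bar>cycle_kernel m e i j\<bar> = cycle_kernel m 1 i j * 1" for j
    using assms(3) by (simp add: cycle_kernel_def path_kernel_def)
  then show ?thesis using sum_cycle_kernel[OF assms(1,2), of 1 "\<lambda>_. 1"] by simp
qed

text \<open>These are the real and imaginary parts of the geometric sum of powers of
  \<open>z\<close>. As \<open>z ^ m = 1\<close>, that sum is m if z = 1 and 0 otherwise.\<close>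

lemma sum_roots_of_unity:
  assumes "m > 0"
  shows "(\<Sum>t<m. cos (2 * pi * of_int p / real m * real t)) = (if int m dvd p then real m else 0)"
    and "(\<Sum>t<m. sin (2 * pi * of_int p / real m * real t)) = 0"
proof -
  define z where "z = cis (2 * pi * of_int p / real m)"
  have zm: "z ^ m = 1"
    using assms cis_multiple_2pi[of "of_int p"] by (simp add: z_def DeMoivre)
  have z1: "z = 1 \<longleftrightarrow> int m dvd p"
  proof
    assume "z = 1"
    then have "cos (2 * pi * of_int p / real m) = 1" by (simp add: z_def complex_eq_iff)
    then obtain q :: int where "2 * pi * of_int p / real m = q * 2 * pi"
      by (auto simp: cos_one_2pi_int)
    then have "of_int p = real_of_int (q * int m)" using assms by (simp add: field_simps)
    then show "int m dvd p" by (simp only: of_int_eq_iff) simp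
  next
    assume "int m dvd p"
    then obtain q where "p = int m * q" by blast
    then have "2 * pi * of_int p / real m = 2 * pi * of_int q" using assms by simp
    then show "z = 1" using cis_multiple_2pi[of "of_int q"] by (simp add: z_def)
  qed
  have "(\<Sum>t<m. z ^ t) = (if int m dvd p then of_nat m else 0)"
    using z1 zm geometric_sum[of z m] by (cases "z = 1") auto
  moreover have "z ^ t = cis (2 * pi * of_int p / real m * real t)" for t
    by (simp add: z_def DeMoivre mult.commute)
  ultimately have *: "(\<Sum>t<m. cis (2 * pi * of_int p / real m * real t)) =
      (if int m dvd p then of_nat m else 0)"
    by simp
  show "(\<Sum>t<m. cos (2 * pi * of_int p / real m * real t)) = (if int m dvd p then real m else 0)"
    using arg_cong[OF *, of Re] by simp
  show "(\<Sum>t<m. sin (2 * pi * of_int p / real m * real t)) = 0"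
    using arg_cong[OF *, of Im] by (simp split: if_splits)
qed

definition cas :: "real \<Rightarrow> real" where
  "cas x = cos x + sin x"

lemma cas_mult_cas: "cas x * cas y = cos (x - y) + sin (x + y)"
  by (simp add: cas_def cos_diff sin_add algebra_simps)

lemma cas_three_term: "cas (x - y) + cas (x + y) = 2 * cos y * cas x"
  by (simp add: cas_def cos_add cos_diff sin_add sin_diff algebra_simps)

definition cycle_angle :: "nat \<Rightarrow> nat \<Rightarrow> nat \<Rightarrow> real" where
  "cycle_angle m r k = (2 * real k - parity r) * pi / real m"

text \<open>A product of two Hartley functions is the cosine of the difference plus the sine of the
  sum. Even for odd r both angles are integer multiples of 2 pi / m: the half-integer shifts cancel
  in the difference and add up to an integer in the sum. Hence the sines sum to 0 and the cosines to
  m or 0.\<close>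

lemma cas_orthogonal:
  assumes "m > 0" "k \<in> {1..m}" "l \<in> {1..m}"
  shows "(\<Sum>t<m. cas (cycle_angle m r k * real t) * cas (cycle_angle m r l * real t)) = 0
    \<longleftrightarrow> k \<noteq> l"
proof -
  have "int m dvd int k - int l \<longleftrightarrow> k = l"
  proof
    assume "int m dvd int k - int l"
    moreover have "\<bar>int k - int l\<bar> < int m" using assms by auto
    ultimately show "k = l" using dvd_imp_le_int[of "int k - int l" "int m"] by force
  qed auto
  moreover have "cycle_angle m r k * real t - cycle_angle m r l * real t =
      2 * pi * of_int (int k - int l) / real m * real t" for t
    by (simp add: cycle_angle_def divide_simps) (simp add: algebra_simps)
  moreover have "cycle_angle m r k * real t + cycle_angle m r l * real t =
      2 * pi * of_int (int k + int l - (if even r then 0 else 1)) / real m * real t" for t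
    by (simp add: cycle_angle_def parity_def divide_simps) (simp add: algebra_simps)
  ultimately have "(\<Sum>t<m. cas (cycle_angle m r k * real t) * cas (cycle_angle m r l * real t)) =
      (if k = l then real m else 0)"
    by (simp only: cas_mult_cas sum.distrib sum_roots_of_unity[OF assms(1)])
  then show ?thesis using assms by simp
qed

text \<open>One turn round the cycle advances the phase by 2 k pi, less pi if r is odd; a shift by
  pi negates both cos and sin.\<close>

lemma cas_cycle_angle_shift:
  assumes "m > 0"
  shows "cas (cycle_angle m r k * (x + real m)) = (- 1) ^ r * cas (cycle_angle m r k * x)"
proof -
  have "cycle_angle m r k * (x + real m) =
      cycle_angle m r k * x - parity r * pi + 2 * real k * pi"
    using assms by (simp add: cycle_angle_def algebra_simps add_divide_distrib diff_divide_distrib)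
  then have "cas (cycle_angle m r k * (x + real m)) = cas (cycle_angle m r k * x - parity r * pi)"
    by (simp add: cas_def cos_add sin_add)
  then show ?thesis by (simp add: cas_def parity_def)
qed

text \<open>Across the closing edge the weight (-1)^r converts the value at m - 1 into the value at
  -1, and the value at 0 into the value at m. So the three-term identity holds at every
  vertex.\<close>

lemma cas_cycle_kernel:
  assumes "m \<ge> 3" "t < m"
  shows "(\<Sum>v<m. cycle_kernel m ((- 1) ^ r) t v * cas (cycle_angle m r k * real v)) =
    2 * cos (cycle_angle m r k) * cas (cycle_angle m r k * real t)"
proof -
  let ?\<theta> = "cycle_angle m r k"
  have sq: "(- 1) ^ r * ((- 1) ^ r * y) = (y::real)" for y
    by (simp flip: power_mult_distrib mult.assoc)
  have "(if t = 0 then (- 1) ^ r * cas (?\<theta> * real (m - 1)) else cas (?\<theta> * real (t - 1))) =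
      cas (?\<theta> * real t - ?\<theta>)"
  proof (cases "t = 0")
    case True
    then show ?thesis
      using cas_cycle_angle_shift[of m r k "- 1"] assms sq by (simp add: of_nat_diff)
  qed (use assms in \<open>simp add: of_nat_diff algebra_simps\<close>)
  moreover have "(if Suc t = m then (- 1) ^ r * cas (?\<theta> * real 0) else cas (?\<theta> * real (Suc t))) =
      cas (?\<theta> * real t + ?\<theta>)"
    using cas_cycle_angle_shift[of m r k 0] assms by (auto simp: algebra_simps)
  ultimately show ?thesis
    unfolding sum_cycle_kernel[OF assms(2,1)] by (simp add: cas_three_term)
qed

lemma eigenbasis_cycle_kernel:
  assumes "m \<ge> 3"
  shows "eigenbasis {..<m} (cycle_kernel m ((- 1) ^ r)) {1..m}
    (\<lambda>k t. cas (cycle_angle m r k * real t)) (\<lambda>k. 2 * cos (cycle_angle m r k))"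
  using assms unfolding eigenbasis_def by (auto simp: cas_cycle_kernel cas_orthogonal)

text \<open>Every vertex of the cycle has degree 2, so the Laplacian is twice the identity minus the
  adjacency kernel and keeps its eigenvectors.\<close>

lemma eigenbasis_laplacian_cycle_kernel:
  assumes "m \<ge> 3"
  shows "eigenbasis {..<m} (laplacian_kernel {..<m} (cycle_kernel m ((- 1) ^ r))) {1..m}
    (\<lambda>k t. cas (cycle_angle m r k * real t)) (\<lambda>k. 2 - 2 * cos (cycle_angle m r k))"
  using assms unfolding eigenbasis_def
  by (auto simp: cas_cycle_kernel cas_orthogonal sum_laplacian_kernel sum_abs_cycle_kernel
      power_abs left_diff_distrib)

section \<open>Switching signed paths and cycles to standard form\<close>

lemma signed_path_switching:
  assumes "is_signed_path n r P"
  shows "switching_equivalent (verts P) (adj P) {..<n} path_kernel"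
proof -
  obtain F where S: "signed_graph P" and F: "bij_betw F {..<n} (verts P)"
    and E: "edges P = {{F i, F (i + 1)} | i. i + 1 < n}"
    using assms by (auto simp: is_signed_path_def atLeast0LessThan)
  define \<sigma> where "\<sigma> i = real_of_int (esign P {F i, F (Suc i)})" for i
  \<comment> \<open>The product of the signs met on the way from vertex 0 to vertex i; thus
    \<open>s i * s (Suc i)\<close> is the sign of the edge between i and its successor.\<close>
  define s where "s i = prod \<sigma> {..<i}" for i
  have \<sigma>: "\<sigma> i * \<sigma> i = 1" if "Suc i < n" for i
  proof -
    have "{F i, F (Suc i)} \<in> edges P" using that unfolding E by auto
    then show ?thesis using S unfolding signed_graph_def \<sigma>_def by fastforce
  qed
  have s: "s i * s i = 1" if "i < n" for i
    unfolding s_def using that \<sigma> by (simp flip: prod.distrib)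
  have inj: "F i = F j \<longleftrightarrow> i = j" if "i < n" "j < n" for i j
    using F that by (auto simp: bij_betw_def dest: inj_onD)
  have edge: "{F i, F j} \<in> edges P \<longleftrightarrow> j = Suc i \<or> i = Suc j" if "i < n" "j < n" for i j
    unfolding E using that by (auto simp: doubleton_eq_iff inj)
  have up: "adj P (F i) (F (Suc i)) = s i * s (Suc i)" if "Suc i < n" for i
    using that s[of i] edge[of i "Suc i"] by (simp add: adj_def \<sigma>_def s_def algebra_simps)
  have "adj P (F i) (F j) = s i * path_kernel i j * s j" if "i < n" "j < n" for i j
  proof -
    consider "j = Suc i" | "i = Suc j" | "\<not> (j = Suc i \<or> i = Suc j)" by blast
    then show ?thesis
    proof cases
      case 1 then show ?thesis using up[of i] that by (simp add: path_kernel_def)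
    next
      case 2 then show ?thesis
        using up[of j] that adj_commute[of P "F i" "F j"] by (simp add: path_kernel_def)
    next
      case 3 then show ?thesis using edge[OF that] by (simp add: path_kernel_def adj_def)
    qed
  qed
  then show ?thesis unfolding switching_equivalent_def using F s by blast
qed

lemma prod_signs:
  fixes \<sigma> :: "'a \<Rightarrow> 'b::comm_ring_1"
  assumes "finite A" "\<And>a. a \<in> A \<Longrightarrow> \<sigma> a = 1 \<or> \<sigma> a = - 1"
  shows "prod \<sigma> A = (- 1) ^ card {a \<in> A. \<sigma> a = - 1}"
  using assms
proof (induction A rule: finite_induct)
  case (insert x A)
  have "{a \<in> insert x A. \<sigma> a = - 1} =
      (if \<sigma> x = - 1 then insert x {a \<in> A. \<sigma> a = - 1} else {a \<in> A. \<sigma> a = - 1})"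
    by auto
  then show ?case using insert insert.prems[of x] by (cases "\<sigma> x = - 1") auto
qed simp

text \<open>Running products absorb every sign except on the closing edge, which is left with the
  product \<open>s m\<close> of all signs. Each of the r negative edges contributes a factor -1 to
  it.\<close>

lemma signed_cycle_switching:
  assumes "is_signed_cycle m r C"
  shows "switching_equivalent (verts C) (adj C) {..<m} (cycle_kernel m ((- 1) ^ r))"
proof -
  obtain F where S: "signed_graph C" and F: "bij_betw F {..<m} (verts C)" and m: "m \<ge> 3"
    and E: "edges C = {{F i, F ((i + 1) mod m)} | i. i < m}"
    and r: "card (negative_edges C) = r"
    using assms by (auto simp: is_signed_cycle_def atLeast0LessThan)
  define \<epsilon> where "\<epsilon> i = {F i, F (Suc i mod m)}" for i
  define \<sigma> where "\<sigma> i = real_of_int (esign C (\<epsilon> i))" for i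
  define s where "s i = prod \<sigma> {..<i}" for i
  have E': "edges C = \<epsilon> ` {..<m}" unfolding E \<epsilon>_def by auto
  have \<sigma>1: "\<sigma> i = 1 \<or> \<sigma> i = - 1" if "i < m" for i
    using S that unfolding signed_graph_def \<sigma>_def E' by fastforce
  then have \<sigma>: "\<sigma> i * \<sigma> i = 1" if "i < m" for i using that by fastforce
  have s: "s i * s i = 1" if "i < m" for i
    unfolding s_def using that \<sigma> by (simp flip: prod.distrib)
  have inj: "F i = F j \<longleftrightarrow> i = j" if "i < m" "j < m" for i j
    using F that by (auto simp: bij_betw_def dest: inj_onD)
  have edge: "{F i, F j} = \<epsilon> l \<longleftrightarrow> i = l \<and> j = Suc l mod m \<or> j = l \<and> i = Suc l mod m"
    if "i < m" "j < m" "l < m" for i j l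
    using that m unfolding \<epsilon>_def by (auto simp: doubleton_eq_iff inj)
  \<comment> \<open>On two vertices both indices would give the same edge; m \<ge> 3 excludes this.
    Injectivity turns the number of negative edges into the number of negative indices.\<close>
  have inj_\<epsilon>: "inj_on \<epsilon> {..<m}"
  proof (rule inj_onI)
    fix i l assume "i \<in> {..<m}" "l \<in> {..<m}" "\<epsilon> i = \<epsilon> l"
    then show "i = l"
      using edge[of i "Suc i mod m" l] m by (auto simp: \<epsilon>_def mod_Suc split: if_splits)
  qed
  have "negative_edges C = \<epsilon> ` {i \<in> {..<m}. \<sigma> i = - 1}"
    unfolding negative_edges_def E' \<sigma>_def by auto
  then have "card {i \<in> {..<m}. \<sigma> i = - 1} = r"
    using r card_image[OF inj_on_subset[OF inj_\<epsilon>]] by (metis (no_types, lifting) mem_Collect_eq subsetI)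
  then have sm: "s m = (- 1) ^ r"
    unfolding s_def using prod_signs[of "{..<m}" \<sigma>] \<sigma>1 by simp
  have adj_\<epsilon>: "adj C (F i) (F (Suc i mod m)) = \<sigma> i" if "i < m" for i
    using that by (simp add: adj_def \<sigma>_def E' flip: \<epsilon>_def)
  have up: "adj C (F i) (F (Suc i)) = s i * s (Suc i)" if "Suc i < m" for i
    using that s[of i] adj_\<epsilon>[of i] by (simp add: s_def algebra_simps)
  have wrap: "adj C (F (m - 1)) (F 0) = s (m - 1) * (- 1) ^ r"
  proof -
    have "s m = s (m - 1) * \<sigma> (m - 1)"
      using m prod.lessThan_Suc[of \<sigma> "m - 1"] by (simp add: s_def)
    then show ?thesis using m s[of "m - 1"] adj_\<epsilon>[of "m - 1"] sm
      by (simp flip: mult.assoc)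
  qed
  have "adj C (F i) (F j) = s i * cycle_kernel m ((- 1) ^ r) i j * s j" if ij: "i < m" "j < m" for i j
  proof -
    have [simp]: "s 0 = 1" by (simp add: s_def)
    consider "i = m - 1" "j = 0" | "i = 0" "j = m - 1" | "j = Suc i" | "i = Suc j"
      | "\<not> (i = 0 \<and> j = m - 1 \<or> i = m - 1 \<and> j = 0)" "\<not> (j = Suc i \<or> i = Suc j)" by blast
    then show ?thesis
    proof cases
      case 1 then show ?thesis using wrap by (simp add: cycle_kernel_def)
    next
      case 2 then show ?thesis using wrap adj_commute[of C "F i" "F j"]
        by (simp add: cycle_kernel_def)
    next
      case 3 then show ?thesis using up[of i] ij m by (auto simp: cycle_kernel_def path_kernel_def)
    next
      case 4 then show ?thesis
        using up[of j] ij m adj_commute[of C "F i" "F j"]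
        by (auto simp: cycle_kernel_def path_kernel_def)
    next
      case 5
      then have "{F i, F j} \<notin> edges C"
        using ij m by (auto simp: E' edge mod_Suc split: if_splits)
      then show ?thesis using 5 by (auto simp: adj_def cycle_kernel_def path_kernel_def)
    qed
  qed
  then show ?thesis unfolding switching_equivalent_def using F s by blast
qed

section \<open>The cylindrical grid\<close>

lemma card_signed_cycle: "is_signed_cycle m r C \<Longrightarrow> card (verts C) = m"
  unfolding is_signed_cycle_def by (auto dest: bij_betw_same_card)

lemma card_signed_path: "is_signed_path n r P \<Longrightarrow> card (verts P) = n"
  unfolding is_signed_path_def by (auto dest: bij_betw_same_card)

lemma sum_Times_fst_snd:
  fixes f :: "'a \<Rightarrow> real"
  shows "(\<Sum>p\<in>A \<times> B. f (fst p) + g (snd p)) = real (card B) * sum f A + real (card A) * sum g B"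
proof -
  have "(\<Sum>p\<in>A \<times> B. f (fst p) + g (snd p)) = (\<Sum>a\<in>A. \<Sum>b\<in>B. f a + g b)"
    unfolding sum.cartesian_product by (intro sum.cong) auto
  then show ?thesis by (simp add: sum.distrib flip: sum_distrib_left)
qed

text \<open>The degrees sum to 2 m over the cycle and 2 (n - 1) over the path, hence to 2 m n + 2 m
  (n - 1) over the grid; division by m n gives the value.\<close>

lemma average_degree_cylinder:
  assumes C: "is_signed_cycle m r1 C" and P: "is_signed_path n r2 P"
  shows "average_degree (cartesian_product C P) = 4 - 2 / real n"
proof -
  have S: "signed_graph C" "signed_graph P" and mn: "m \<ge> 3" "n \<ge> 1"
    using C P by (auto simp: is_signed_cycle_def is_signed_path_def)
  have V: "verts (cartesian_product C P) = verts C \<times> verts P"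
    by (simp add: cartesian_product_def)
  have fin: "finite (verts C)" "finite (verts P)" using S by (auto simp: signed_graph_def)
  note card = card_signed_cycle[OF C] card_signed_path[OF P]
  have "(\<Sum>q\<in>verts C \<times> verts P. \<bar>adj (cartesian_product C P) p q\<bar>) =
      (\<Sum>u\<in>verts C. \<bar>adj C (fst p) u\<bar>) + (\<Sum>v\<in>verts P. \<bar>adj P (snd p) v\<bar>)"
    if "p \<in> verts C \<times> verts P" for p
    using that sum_abs_kron_sum[OF fin, of "fst p" "snd p" "adj C" "adj P"]
    by (auto simp: adj_cartesian_product[OF S that] adj_self[OF S(1)] adj_self[OF S(2)])
  then have "2 * real (card (edges (cartesian_product C P))) =
    (\<Sum>p\<in>verts C \<times> verts P.
      (\<Sum>u\<in>verts C. \<bar>adj C (fst p) u\<bar>) + (\<Sum>v\<in>verts P. \<bar>adj P (snd p) v\<bar>))"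
    unfolding handshake[OF signed_graph_cartesian_product[OF S]] V by simp
  also have "\<dots> = real n * (\<Sum>a\<in>verts C. \<Sum>u\<in>verts C. \<bar>adj C a u\<bar>) +
      real m * (\<Sum>b\<in>verts P. \<Sum>v\<in>verts P. \<bar>adj P b v\<bar>)"
    by (simp only: card sum_Times_fst_snd[where f = "\<lambda>a. \<Sum>u\<in>verts C. \<bar>adj C a u\<bar>" and
          g = "\<lambda>b. \<Sum>v\<in>verts P. \<bar>adj P b v\<bar>"])
  also have "(\<Sum>a\<in>verts C. \<Sum>u\<in>verts C. \<bar>adj C a u\<bar>) = 2 * real m"
    using mn by (simp add: sum_sum_abs_switching[OF signed_cycle_switching[OF C]]
        sum_abs_cycle_kernel power_abs)
  also have "(\<Sum>b\<in>verts P. \<Sum>v\<in>verts P. \<bar>adj P b v\<bar>) =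
      (\<Sum>i<n. (if 0 < i then 1 else 0) + (if Suc i < n then 1 else 0))"
    by (simp add: sum_sum_abs_switching[OF signed_path_switching[OF P]] sum_abs_path_kernel)
  also have "\<dots> = 2 * (real n - 1)"
  proof -
    have "{i. i < n \<and> 0 < i} = {1..<n}" "{i. i < n \<and> Suc i < n} = {..<n - 1}" by auto
    then show ?thesis
      using mn by (simp add: sum.distrib sum.If_cases Int_def of_nat_diff)
  qed
  finally show ?thesis
    using mn unfolding average_degree_def V
    by (simp add: card_cartesian_product card field_simps)
qed

lemma eigenvalues_cylinder:
  assumes C: "is_signed_cycle m r1 C" and P: "is_signed_path n r2 P"
  shows "eigenvalues (cartesian_product C P) =
    {# 2 * (cos (cycle_angle m r1 i) + cos (real j * pi / real (n + 1))).
       (i, j) \<in># mset_set ({1..m} \<times> {1..n}) #}"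
proof -
  have S: "signed_graph C" "signed_graph P" and m: "m \<ge> 3"
    using C P by (auto simp: is_signed_cycle_def is_signed_path_def)
  have V: "verts (cartesian_product C P) = verts C \<times> verts P"
    by (simp add: cartesian_product_def)
  obtain \<phi> where \<phi>: "eigenbasis (verts C) (adj C) {1..m} \<phi> (\<lambda>i. 2 * cos (cycle_angle m r1 i))"
    using eigenbasis_switching[OF signed_cycle_switching[OF C] eigenbasis_cycle_kernel[OF m]] .
  obtain \<psi> where \<psi>: "eigenbasis (verts P) (adj P) {1..n} \<psi> (\<lambda>j. 2 * cos (real j * pi / real (n + 1)))"
    using eigenbasis_switching[OF signed_path_switching[OF P] eigenbasis_path_kernel] .
  show ?thesis
  proof (rule eigenvalues_eigenbasis[OF signed_graph_cartesian_product[OF S]])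
    show "eigenbasis (verts (cartesian_product C P)) (adj (cartesian_product C P))
        ({1..m} \<times> {1..n}) (\<lambda>(k, l) (u, v). \<phi> k u * \<psi> l v)
        (\<lambda>(i, j). 2 * (cos (cycle_angle m r1 i) + cos (real j * pi / real (n + 1))))"
      unfolding V by (intro eigenbasis_cong[OF eigenbasis_kron_sum[OF \<phi> \<psi>]])
        (auto simp: adj_cartesian_product[OF S])
  qed
qed

lemma laplacian_eigenvalues_cylinder:
  assumes C: "is_signed_cycle m r1 C" and P: "is_signed_path n r2 P"
  shows "laplacian_eigenvalues (cartesian_product C P) =
    {# 2 * (2 - cos (cycle_angle m r1 i) + cos (real j * pi / real n)).
       (i, j) \<in># mset_set ({1..m} \<times> {1..n}) #}"
proof -
  have S: "signed_graph C" "signed_graph P" and m: "m \<ge> 3"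
    using C P by (auto simp: is_signed_cycle_def is_signed_path_def)
  have V: "verts (cartesian_product C P) = verts C \<times> verts P"
    by (simp add: cartesian_product_def)
  have fin: "finite (verts C)" "finite (verts P)" using S by (auto simp: signed_graph_def)
  obtain \<phi> where \<phi>: "eigenbasis (verts C) (laplacian_kernel (verts C) (adj C)) {1..m} \<phi>
      (\<lambda>i. 2 - 2 * cos (cycle_angle m r1 i))"
    using eigenbasis_switching[OF
        switching_equivalent_laplacian_kernel[OF signed_cycle_switching[OF C]]
        eigenbasis_laplacian_cycle_kernel[OF m]] .
  obtain \<psi> where \<psi>: "eigenbasis (verts P) (laplacian_kernel (verts P) (adj P)) {1..n} \<psi>
      (\<lambda>j. 2 + 2 * cos (real j * pi / real n))"
    using eigenbasis_switching[OF
        switching_equivalent_laplacian_kernel[OF signed_path_switching[OF P]]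
        eigenbasis_laplacian_path_kernel] .
  \<comment> \<open>Since neither factor has loops, the Laplacian of the Kronecker sum is the
    Kronecker sum of the Laplacians, and the two eigenbases combine as for the adjacency
    kernels.\<close>
  have "laplacian_kernel (verts C \<times> verts P) (adj (cartesian_product C P)) p q =
      kron_sum (laplacian_kernel (verts C) (adj C)) (laplacian_kernel (verts P) (adj P)) p q"
    if "p \<in> verts C \<times> verts P" for p q
    unfolding laplacian_kernel_kron_sum[OF fin that, of "adj C" "adj P", symmetric, OF
        adj_self[OF S(1)] adj_self[OF S(2)]]
    using that by (auto simp: laplacian_kernel_def adj_cartesian_product[OF S])
  then have "eigenbasis (verts (cartesian_product C P))
      (laplacian_kernel (verts (cartesian_product C P)) (adj (cartesian_product C P)))
      ({1..m} \<times> {1..n}) (\<lambda>(k, l) (u, v). \<phi> k u * \<psi> l v)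
      (\<lambda>(i, j). 2 * (2 - cos (cycle_angle m r1 i) + cos (real j * pi / real n)))"
    unfolding V by (intro eigenbasis_cong[OF eigenbasis_kron_sum[OF \<phi> \<psi>]]) auto
  then show ?thesis
    by (rule laplacian_eigenvalues_eigenbasis[OF signed_graph_cartesian_product[OF S]])
qed

text \<open>The angle is a multiple of 2 pi only if 2 i - [r] is a multiple of 2 m. Parity excludes
  odd r; then m divides i, and 1 \<le> i \<le> m leaves i = m.\<close>

lemma cos_cycle_angle_eq_1_iff:
  assumes "m > 0" "i \<in> {1..m}"
  shows "cos (cycle_angle m r i) = 1 \<longleftrightarrow> i = m \<and> even r"
proof
  assume "cos (cycle_angle m r i) = 1"
  then obtain q :: int where "cycle_angle m r i = q * 2 * pi" by (auto simp: cos_one_2pi_int)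
  then have "(2 * real i - parity r) * pi = (real_of_int q * 2 * real m) * pi"
    using assms(1) by (simp add: cycle_angle_def field_simps)
  then have "2 * real i - parity r = real_of_int q * 2 * real m"
    by simp
  then have "real_of_int (2 * int i - (if even r then 0 else 1)) = real_of_int (q * 2 * int m)"
    by (cases "even r") (simp_all add: parity_def)
  then have *: "2 * int i - (if even r then 0 else 1) = q * 2 * int m"
    by (simp only: of_int_eq_iff)
  have "even r"
  proof (rule ccontr)
    assume "odd r"
    moreover define k where "k = q * int m"
    ultimately have "2 * int i - 1 = 2 * k" using * by simp
    then show False by presburger
  qed
  then have "int i = q * int m" using * by simp
  then have "int m dvd int i" by (metis dvd_triv_right)
  then have "m \<le> i" using assms dvd_imp_le[of m i] by simp
  then show "i = m \<and> even r" using \<open>even r\<close> assms by simp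
qed (use assms in \<open>simp add: cycle_angle_def parity_def\<close>)

text \<open>The angles lie in [0, pi], where cos is injective and reaches -1 only at pi.\<close>

lemma cos_path_angle_eq_minus_1_iff:
  assumes "j \<in> {1..n}"
  shows "cos (real j * pi / real n) = - 1 \<longleftrightarrow> j = n"
proof
  assume "cos (real j * pi / real n) = - 1"
  then have "cos (real j * pi / real n) = cos pi" by simp
  moreover have "0 \<le> real j * pi / real n" "real j * pi / real n \<le> pi"
    using assms by (auto simp: field_simps)
  ultimately have "real j * pi / real n = pi" using cos_inj_pi pi_ge_zero by blast
  then have "real j * pi = real n * pi" using assms by (simp add: field_simps)
  then show "j = n" by simp
qed (use assms in simp)

theorem corollary4p6:
  fixes C :: "'a sgraph" and P :: "'b sgraph" and m n r1 r2 :: nat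
  assumes "is_signed_cycle m r1 C" and "is_signed_path n r2 P"
    and "0 \<le> r1" and "r1 \<le> m" and "0 \<le> r2" and "r2 \<le> n - 1"
  shows
    "eigenvalues (cartesian_product C P) =
       {# 2 * (cos ((2 * real i - parity r1) * pi / real m) + cos (real j * pi / real (n + 1))).
          (i, j) \<in># mset_set ({1..m} \<times> {1..n}) #} \<and>
     energy (cartesian_product C P) =
       2 * (\<Sum>i = 1..m. \<Sum>j = 1..n.
         \<bar>cos ((2 * real i - parity r1) * pi / real m) + cos (real j * pi / real (n + 1))\<bar>) \<and>
     laplacian_eigenvalues (cartesian_product C P) =
       {# 2 * (2 - cos ((2 * real i - parity r1) * pi / real m) + cos (real j * pi / real n)).
          (i, j) \<in># mset_set ({1..m} \<times> {1..n}) #} \<and>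
     (\<forall>i \<in> {1..m}. \<forall>j \<in> {1..n}.
        2 * (2 - cos ((2 * real i - parity r1) * pi / real m) + cos (real j * pi / real n)) > 0
          \<longleftrightarrow> \<not> (i = m \<and> j = n \<and> even r1)) \<and>
     laplacian_energy (cartesian_product C P) =
       2 * (\<Sum>i = 1..m. \<Sum>j = 1..n.
         \<bar>1 / real n - cos ((2 * real i - parity r1) * pi / real m) + cos (real j * pi / real n)\<bar>)"
  unfolding cycle_angle_def[symmetric]
proof (intro conjI ballI)
  note C = assms(1) and P = assms(2)
  note ev = eigenvalues_cylinder[OF C P] laplacian_eigenvalues_cylinder[OF C P]
  \<comment> \<open>Both energies have this form: the centre \<open>2 * d\<close> is 0 for the
    adjacency spectrum and the average degree for the Laplacian one.\<close>
  have energy: "(\<Sum>x\<in>#{# 2 * f i j. (i, j) \<in># mset_set ({1..m} \<times> {1..n}) #}. \<bar>x - 2 * d\<bar>) =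
      2 * (\<Sum>i = 1..m. \<Sum>j = 1..n. \<bar>f i j - d\<bar>)" for f :: "nat \<Rightarrow> nat \<Rightarrow> real" and d
  proof -
    have "\<bar>2 * x - 2 * d\<bar> = 2 * \<bar>x - d\<bar>" for x :: real
      by (simp add: abs_if)
    then show ?thesis
      by (simp add: image_mset.compositionality o_def split_beta sum_distrib_left
          sum.cartesian_product flip: sum_unfold_sum_mset)
  qed
  show "eigenvalues (cartesian_product C P) =
       {# 2 * (cos (cycle_angle m r1 i) + cos (real j * pi / real (n + 1))).
          (i, j) \<in># mset_set ({1..m} \<times> {1..n}) #}"
    by (rule ev)
  show "energy (cartesian_product C P) =
      2 * (\<Sum>i = 1..m. \<Sum>j = 1..n. \<bar>cos (cycle_angle m r1 i) + cos (real j * pi / real (n + 1))\<bar>)"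
    unfolding energy_def ev
    using energy[where d = 0 and
        f = "\<lambda>i j. cos (cycle_angle m r1 i) + cos (real j * pi / real (n + 1))"]
    by (simp only: mult_zero_right diff_zero)
  show "laplacian_eigenvalues (cartesian_product C P) =
       {# 2 * (2 - cos (cycle_angle m r1 i) + cos (real j * pi / real n)).
          (i, j) \<in># mset_set ({1..m} \<times> {1..n}) #}"
    by (rule ev)
  \<comment> \<open>Here d = 2 - 1 / n is half the average degree; subtracting it from half an
    eigenvalue turns the constant 2 into 1 / n.\<close>
  have lap: "4 - 2 / real n = 2 * (2 - 1 / real n)"
    "1 / real n - x + y = 2 - x + y - (2 - 1 / real n)" for x y
    by simp_all
  show "laplacian_energy (cartesian_product C P) =
      2 * (\<Sum>i = 1..m. \<Sum>j = 1..n.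
        \<bar>1 / real n - cos (cycle_angle m r1 i) + cos (real j * pi / real n)\<bar>)"
    unfolding laplacian_energy_def ev average_degree_cylinder[OF C P] lap by (rule energy)
  \<comment> \<open>Half the eigenvalue is 1 minus one cosine plus 1 plus the other: two nonnegative
    terms, so it is positive unless both vanish.\<close>
  fix i j assume ij: "i \<in> {1..m}" "j \<in> {1..n}"
  then have "m > 0" by auto
  then show "0 < 2 * (2 - cos (cycle_angle m r1 i) + cos (real j * pi / real n)) \<longleftrightarrow>
      \<not> (i = m \<and> j = n \<and> even r1)"
    using cos_cycle_angle_eq_1_iff[OF _ ij(1), of r1] cos_path_angle_eq_minus_1_iff[OF ij(2)]
      cos_le_one[of "cycle_angle m r1 i"] cos_ge_minus_one[of "real j * pi / real n"]
    by argo
qed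

end
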